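(* Given the set of conserved variables $(\varrho,\varrho v,\varrho\theta)$, a numerical flux $(f^{\mathrm{num}}_\varrho,f^{\mathrm{num}}_{\varrho v},f^{\mathrm{num}}_{\varrho\theta})$, a source term $S^{\varrho v}$ and the corresponding finite volume method with gravity are total energy-conservative (TEC, including the potential energy) if (i) the density flux and the source term are of the form $f^{\mathrm{num}}_\varrho=\overline{\varrho}\,\{\!\{v\}\!\}$ and $S^{\varrho v}=\overline{\varrho}\,[\![\phi]\!]$ with the same mean value $\overline\varrho$; and (ii) the numerical flux is of the form $$f^{\mathrm{num}}_{\varrho}=\text{any consistent and symmetric flux of }\varrho v,\qquad f^{\mathrm{num}}_{\varrho v}=f^{\mathrm{num}}_\varrho\{\!\{v\}\!\}+\{\!\{p\}\!\},\qquad f^{\mathrm{num}}_{\varrho\theta}=\{\!\{\varrho\theta\}\!\}_\gamma\{\!\{v\}\!\}.$$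
   Context: The equations are $\partial_t\varrho+\partial_x(\varrho v)=0$, $\partial_t(\varrho v)+\partial_x(\varrho v^2+p)=-\varrho\,\partial_x\phi$, $\partial_t(\varrho\theta)+\partial_x(\varrho\theta v)=0$, with $\varrho,\theta>0$, $p=K(\varrho\theta)^\gamma$, constants $K>0$, $\gamma>1$, and a time-independent geopotential $\phi=\phi(x)$. At the interface $i+\frac12$ between cells $i$ (left) and $i+1$ (right): $[\![a]\!]_{i+1/2}=a_{i+1}-a_i$, $\{\!\{a\}\!\}_{i+1/2}=(a_{i+1}+a_i)/2$, and $\{\!\{a\}\!\}_\gamma=\frac{\gamma-1}{\gamma}\frac{[\![a^\gamma]\!]}{[\![a^{\gamma-1}]\!]}$ for positive arguments (equal to $a$ if both values are $a$). $\overline\varrho_{i+1/2}$ is any consistent mean value of the density: a two-point function of the adjacent states with $\overline\varrho_{i+1/2}=\varrho$ whenever $\varrho_i=\varrho_{i+1}=\varrho$. A numerical flux component is symmetric if unchanged when the two states are swapped, and consistent if it equals the exact flux for equal states. The finite volume method is $$\partial_tu_i+\frac1{\Delta x}(f_{i+1/2}-f_{i-1/2})=-\mathcal S_i,\quad f_{i+1/2}=f^{\mathrm{num}}(u_i,u_{i+1}),\quad \mathcal S_i=(0,\mathcal S_i^{\varrho v},0),\quad \mathcal S^{\varrho v}_i=\frac{S^{\varrho v}_{i+1/2}+S^{\varrho v}_{i-1/2}}{2\Delta x}.$$ The method is TEC if the total energy $U=\varrho E+\varrho\phi=\frac p{\gamma-1}+\frac12\varrho v^2+\varrho\phi$ satisfies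 a semi-discrete conservation law $\frac{dU_i}{dt}=-\frac1{\Delta x}(H_{i+1/2}-H_{i-1/2})$ for all $i$, where $H_{i+1/2}$ is a two-point function of $(u_i,\phi_i)$ and $(u_{i+1},\phi_{i+1})$, consistent with the total energy flux $(\varrho E+p+\varrho\phi)v$. *)

theory Defs
  imports "HOL-Analysis.Analysis"
begin

text \<open>A state is the vector \<open>(\<rho>, \<rho> v, \<rho> \<theta>)\<close> of conserved variables.\<close>

type_synonym state = "real \<times> real \<times> real"

definition dens :: "state \<Rightarrow> real" where
  "dens u = fst u"

definition mom :: "state \<Rightarrow> real" where
  "mom u = fst (snd u)"

definition dens_theta :: "state \<Rightarrow> real" where
  "dens_theta u = snd (snd u)"

definition vel :: "state \<Rightarrow> real" where
  "vel u = mom u / dens u"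

definition theta :: "state \<Rightarrow> real" where
  "theta u = dens_theta u / dens u"

definition admissible :: "state \<Rightarrow> bool" where
  "admissible u \<longleftrightarrow> dens u > 0 \<and> theta u > 0"

definition pressure :: "real \<Rightarrow> real \<Rightarrow> state \<Rightarrow> real" where
  "pressure K \<gamma> u = K * dens_theta u powr \<gamma>"

text \<open>\<open>\<rho> E\<close>, the total energy without the potential energy.\<close>

definition dens_E :: "real \<Rightarrow> real \<Rightarrow> state \<Rightarrow> real" where
  "dens_E K \<gamma> u = pressure K \<gamma> u / (\<gamma> - 1) + 1/2 * dens u * (vel u)\<^sup>2"

definition total_energy :: "real \<Rightarrow> real \<Rightarrow> state \<Rightarrow> real \<Rightarrow> real" where
  "total_energy K \<gamma> u \<phi> = dens_E K \<gamma> u + dens u * \<phi>"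

definition total_energy_flux :: "real \<Rightarrow> real \<Rightarrow> state \<Rightarrow> real \<Rightarrow> real" where
  "total_energy_flux K \<gamma> u \<phi> = (dens_E K \<gamma> u + pressure K \<gamma> u + dens u * \<phi>) * vel u"

definition jump :: "real \<Rightarrow> real \<Rightarrow> real" where
  "jump aL aR = aR - aL"

definition avg :: "real \<Rightarrow> real \<Rightarrow> real" where
  "avg aL aR = (aR + aL) / 2"

definition gamma_mean :: "real \<Rightarrow> real \<Rightarrow> real \<Rightarrow> real" where
  "gamma_mean \<gamma> aL aR =
    (if aL = aR then aL
     else (\<gamma> - 1) / \<gamma> * (jump (aL powr \<gamma>) (aR powr \<gamma>)
                         / jump (aL powr (\<gamma> - 1)) (aR powr (\<gamma> - 1))))"

text \<open>Equality of the densities alone is required here; velocity and potential temperature of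
  the two states may differ.\<close>

definition density_mean :: "(state \<Rightarrow> state \<Rightarrow> real) \<Rightarrow> bool" where
  "density_mean \<rho>bar \<longleftrightarrow>
    (\<forall>uL uR. admissible uL \<longrightarrow> admissible uR \<longrightarrow> dens uL = dens uR \<longrightarrow> \<rho>bar uL uR = dens uL)"

definition symmetric_flux :: "(state \<Rightarrow> state \<Rightarrow> real) \<Rightarrow> bool" where
  "symmetric_flux f \<longleftrightarrow>
    (\<forall>uL uR. admissible uL \<longrightarrow> admissible uR \<longrightarrow> f uL uR = f uR uL)"

definition consistent_flux :: "(state \<Rightarrow> state \<Rightarrow> real) \<Rightarrow> (state \<Rightarrow> real) \<Rightarrow> bool" where
  "consistent_flux f exact \<longleftrightarrow> (\<forall>u. admissible u \<longrightarrow> f u u = exact u)"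

text \<open>The value that the method prescribes for the time derivative of \<open>u\<^sub>i\<close>. The interface source
  \<open>S\<close> is a two-point function of the states paired with the geopotential values.\<close>

definition fv_rhs ::
  "real \<Rightarrow> (state \<Rightarrow> state \<Rightarrow> state) \<Rightarrow> (state \<times> real \<Rightarrow> state \<times> real \<Rightarrow> real)
    \<Rightarrow> (int \<Rightarrow> real) \<Rightarrow> (int \<Rightarrow> state) \<Rightarrow> int \<Rightarrow> state" where
  "fv_rhs \<Delta>x f S \<phi> u i =
    - ((1 / \<Delta>x) *\<^sub>R (f (u i) (u (i + 1)) - f (u (i - 1)) (u i)))
    - (0, (S (u i, \<phi> i) (u (i + 1), \<phi> (i + 1)) + S (u (i - 1), \<phi> (i - 1)) (u i, \<phi> i)) / (2 * \<Delta>x), 0)"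

definition fv_method_at ::
  "real \<Rightarrow> (state \<Rightarrow> state \<Rightarrow> state) \<Rightarrow> (state \<times> real \<Rightarrow> state \<times> real \<Rightarrow> real)
    \<Rightarrow> (int \<Rightarrow> real) \<Rightarrow> (real \<Rightarrow> int \<Rightarrow> state) \<Rightarrow> real set \<Rightarrow> real \<Rightarrow> bool" where
  "fv_method_at \<Delta>x f S \<phi> u T t \<longleftrightarrow>
    (\<forall>i. ((\<lambda>s. u s i) has_vector_derivative fv_rhs \<Delta>x f S \<phi> (u t) i) (at t within T))"

text \<open>The flux \<open>H\<close> depends on the two adjacent states and geopotential values only, not on the
  grid, the potential or the solution. The method is assumed, and the conservation law asserted, at
  a single time \<open>t\<close>: this gives the law at all times for every solution on \<open>T\<close>, and it keeps its
  content for fluxes so irregular that the system of ODEs has no solutions on an interval.\<close>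

definition TEC ::
  "real \<Rightarrow> real \<Rightarrow> (state \<Rightarrow> state \<Rightarrow> state) \<Rightarrow> (state \<times> real \<Rightarrow> state \<times> real \<Rightarrow> real) \<Rightarrow> bool" where
  "TEC K \<gamma> f S \<longleftrightarrow>
    (\<exists>H :: state \<times> real \<Rightarrow> state \<times> real \<Rightarrow> real.
      (\<forall>u \<phi>. admissible u \<longrightarrow> H (u, \<phi>) (u, \<phi>) = total_energy_flux K \<gamma> u \<phi>) \<and>
      (\<forall>\<Delta>x > 0. \<forall>\<phi> u T t.
        is_interval T \<longrightarrow> t \<in> T \<longrightarrow> (\<forall>s\<in>T. \<forall>i. admissible (u s i)) \<longrightarrow>
        fv_method_at \<Delta>x f S \<phi> u T t \<longrightarrow>
        (\<forall>i. ((\<lambda>s. total_energy K \<gamma> (u s i) (\<phi> i)) has_real_derivative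
                - (1 / \<Delta>x) * (H (u t i, \<phi> i) (u t (i + 1), \<phi> (i + 1))
                              - H (u t (i - 1), \<phi> (i - 1)) (u t i, \<phi> i)))
              (at t within T))))"

end

theory Submission imports Defs
begin

text \<open>Let \<open>W(u, \<phi>)\<close> be the differential of the total energy with respect to \<open>(\<rho>, \<rho> v, \<rho> \<theta>)\<close>,
  that is \<open>W = (\<phi> - v\<^sup>2/2, v, K \<gamma> / (\<gamma> - 1) (\<rho>\<theta>)\<^bsup>\<gamma> - 1\<^esup>)\<close>. By the chain rule, an interface with
  flux \<open>f\<close> and source \<open>S\<close> takes \<open>A\<^sub>L = W\<^sub>L \<cdot> f + v\<^sub>L S / 2\<close> out of its left cell and brings
  \<open>A\<^sub>R = W\<^sub>R \<cdot> f - v\<^sub>R S / 2\<close> into its right cell. The energy is therefore conserved as soon as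
  the discrepancy \<open>A\<^sub>R - A\<^sub>L\<close> is the jump of a function \<open>\<psi>\<close> of the state, with
  \<open>H = A\<^sub>L - \<psi>\<^sub>L = A\<^sub>R - \<psi>\<^sub>R\<close> as energy flux. Here \<open>\<psi> = p v\<close>; with \<open>[a]\<close> for the
  jump and \<open>{a}\<close> for the arithmetic mean,

  \<^item> the geopotential terms \<open>[\<phi>] f\<^sub>\<rho>\<close> and \<open>- {v} S\<close> cancel, because the density flux and
    the source contain the same mean density;
  \<^item> \<open>- [v\<^sup>2/2] f\<^sub>\<rho> + [v] ({v} f\<^sub>\<rho> + {p}) = [v] {p}\<close>;
  \<^item> the \<open>\<gamma>\<close>-mean is made so that the third component contributes \<open>{v} [p]\<close>
    (\<open>gamma_mean_pressure_jump\<close>);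
  \<^item> \<open>[v] {p} + {v} [p] = [p v]\<close>.

  The identity \<open>A\<^sub>R - A\<^sub>L = [p v]\<close> is \<open>interface_energy_balance\<close>, the chain rule is
  \<open>total_energy_has_derivative\<close>. For equal states \<open>H = W \<cdot> f - p v\<close> is the exact energy flux,
  since \<open>\<gamma> / (\<gamma> - 1) = 1 / (\<gamma> - 1) + 1\<close>.\<close>

text \<open>The differential \<open>W(u, \<phi>)\<close> of the total energy with respect to the conserved variables,
  applied to a vector.\<close>

definition energy_differential :: "real \<Rightarrow> real \<Rightarrow> state \<Rightarrow> real \<Rightarrow> state \<Rightarrow> real" where
  "energy_differential K \<gamma> u \<phi> h =
    (\<phi> - (vel u)\<^sup>2 / 2) * dens h + vel u * mom h
    + K * \<gamma> / (\<gamma> - 1) * dens_theta u powr (\<gamma> - 1) * dens_theta h"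

text \<open>The numerical energy flux \<open>A\<^sub>L - p\<^sub>L v\<^sub>L\<close>, written in terms of the left cell.\<close>

definition energy_flux ::
  "real \<Rightarrow> real \<Rightarrow> (state \<Rightarrow> state \<Rightarrow> state) \<Rightarrow> (state \<times> real \<Rightarrow> state \<times> real \<Rightarrow> real)
    \<Rightarrow> state \<times> real \<Rightarrow> state \<times> real \<Rightarrow> real" where
  "energy_flux K \<gamma> f S xL xR =
    energy_differential K \<gamma> (fst xL) (snd xL) (f (fst xL) (fst xR))
    + vel (fst xL) * S xL xR / 2 - pressure K \<gamma> (fst xL) * vel (fst xL)"

lemma admissible_dens_theta_pos: "admissible u \<Longrightarrow> dens_theta u > 0"
  by (auto simp: admissible_def theta_def zero_less_divide_iff)

lemma energy_differential_fv_rhs: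
  "energy_differential K \<gamma> w \<psi> (fv_rhs \<Delta>x f S \<phi> u i) =
    - (1 / \<Delta>x) *
      ((energy_differential K \<gamma> w \<psi> (f (u i) (u (i + 1)))
          + vel w * S (u i, \<phi> i) (u (i + 1), \<phi> (i + 1)) / 2)
       - (energy_differential K \<gamma> w \<psi> (f (u (i - 1)) (u i))
          - vel w * S (u (i - 1), \<phi> (i - 1)) (u i, \<phi> i) / 2))"
  by (simp add: energy_differential_def fv_rhs_def dens_def mom_def dens_theta_def
      algebra_simps diff_divide_distrib add_divide_distrib)

lemma total_energy_has_derivative:
  assumes deriv: "(u has_vector_derivative u') (at t within T)"
    and adm: "admissible (u t)"
  shows "((\<lambda>s. total_energy K \<gamma> (u s) \<phi>) has_real_derivative
           energy_differential K \<gamma> (u t) \<phi> u') (at t within T)"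
proof -
  have d: "((\<lambda>s. dens (u s)) has_real_derivative dens u') (at t within T)"
    and m: "((\<lambda>s. mom (u s)) has_real_derivative mom u') (at t within T)"
    and q: "((\<lambda>s. dens_theta (u s)) has_real_derivative dens_theta u') (at t within T)"
    unfolding dens_def mom_def dens_theta_def has_real_derivative_iff_has_vector_derivative
    by (intro bounded_linear.has_vector_derivative[OF bounded_linear_fst]
        bounded_linear.has_vector_derivative[OF bounded_linear_snd] deriv)+
  have d0: "dens (u t) > 0" and q0: "dens_theta (u t) > 0"
    using adm admissible_dens_theta_pos by (auto simp: admissible_def)
  have powr: "((\<lambda>s. dens_theta (u s) powr \<gamma>) has_real_derivative
      \<gamma> * dens_theta (u t) powr (\<gamma> - 1) * dens_theta u') (at t within T)"
    by (rule DERIV_chain2[OF has_real_derivative_powr[OF q0] q])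
  have v: "((\<lambda>s. vel (u s)) has_real_derivative
      (mom u' - vel (u t) * dens u') / dens (u t)) (at t within T)"
    unfolding vel_def
    by (rule DERIV_cong[OF DERIV_divide[OF m d]])
      (use d0 in \<open>simp_all add: field_simps power2_eq_square\<close>)
  have kinetic: "((\<lambda>s. 1/2 * dens (u s) * (vel (u s))\<^sup>2) has_real_derivative
      - (vel (u t))\<^sup>2 / 2 * dens u' + vel (u t) * mom u') (at t within T)"
    by (rule DERIV_cong[OF DERIV_mult[OF DERIV_cmult[OF d] DERIV_power[OF v]]])
      (use d0 in \<open>simp add: field_simps power2_eq_square\<close>)
  have internal: "((\<lambda>s. pressure K \<gamma> (u s) / (\<gamma> - 1)) has_real_derivative
      K * \<gamma> / (\<gamma> - 1) * dens_theta (u t) powr (\<gamma> - 1) * dens_theta u') (at t within T)"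
    unfolding pressure_def
    by (rule DERIV_cong[OF DERIV_cdivide[OF DERIV_cmult[OF powr]]]) simp
  have potential: "((\<lambda>s. dens (u s) * \<phi>) has_real_derivative dens u' * \<phi>) (at t within T)"
    by (rule DERIV_cmult_right[OF d])
  show ?thesis
    unfolding total_energy_def dens_E_def energy_differential_def
    by (rule DERIV_cong[OF DERIV_add[OF DERIV_add[OF internal kinetic] potential]])
      (simp add: algebra_simps)
qed

lemma gamma_mean_pressure_jump:
  assumes "a > 0" and "b > 0" and "\<gamma> > 1"
  shows "K * \<gamma> / (\<gamma> - 1) * (b powr (\<gamma> - 1) - a powr (\<gamma> - 1)) * gamma_mean \<gamma> a b
    = K * b powr \<gamma> - K * a powr \<gamma>"
proof (cases "a = b")
  case False
  then have "b powr (\<gamma> - 1) - a powr (\<gamma> - 1) \<noteq> 0"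
    using assms powr_less_mono2[of "\<gamma> - 1" a b] powr_less_mono2[of "\<gamma> - 1" b a]
    by linarith
  then show ?thesis
    unfolding gamma_mean_def jump_def right_diff_distrib[symmetric, of K]
    using False \<open>\<gamma> > 1\<close> by simp
qed simp

text \<open>The identity \<open>A\<^sub>L - p\<^sub>L v\<^sub>L = A\<^sub>R - p\<^sub>R v\<^sub>R\<close> at one interface, with mean density
  \<open>\<rho>m\<close>, flux \<open>h\<close> and source \<open>s\<close>: the energy flux can be read off from either cell.\<close>

lemma interface_energy_balance:
  assumes adm: "admissible uL" "admissible uR" and "\<gamma> > 1"
    and r: "r = \<rho>m * avg (vel uL) (vel uR)"
    and s: "s = \<rho>m * jump \<phi>L \<phi>R"
    and h: "h = (r, r * avg (vel uL) (vel uR) + avg (pressure K \<gamma> uL) (pressure K \<gamma> uR),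
                gamma_mean \<gamma> (dens_theta uL) (dens_theta uR) * avg (vel uL) (vel uR))"
  shows "energy_differential K \<gamma> uL \<phi>L h + vel uL * s / 2 - pressure K \<gamma> uL * vel uL
    = energy_differential K \<gamma> uR \<phi>R h - vel uR * s / 2 - pressure K \<gamma> uR * vel uR"
proof -
  define c where "c = K * \<gamma> / (\<gamma> - 1)"
  define g where "g = gamma_mean \<gamma> (dens_theta uL) (dens_theta uR)"
  define a where "a = dens_theta uL powr (\<gamma> - 1)"
  define b where "b = dens_theta uR powr (\<gamma> - 1)"
  have "c * (b - a) * g = pressure K \<gamma> uR - pressure K \<gamma> uL"
    unfolding c_def g_def a_def b_def pressure_def
    using adm \<open>\<gamma> > 1\<close> by (intro gamma_mean_pressure_jump admissible_dens_theta_pos)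
  then have "c * b * g * ((vel uR + vel uL) / 2) - c * a * g * ((vel uR + vel uL) / 2)
      = (pressure K \<gamma> uR - pressure K \<gamma> uL) * ((vel uR + vel uL) / 2)"
    by (metis left_diff_distrib right_diff_distrib)
  then show ?thesis
    unfolding energy_differential_def h r s dens_def mom_def dens_theta_def fst_conv snd_conv
    unfolding dens_theta_def[symmetric] c_def[symmetric] g_def[symmetric] a_def[symmetric]
      b_def[symmetric] avg_def jump_def
    by (simp add: field_simps power2_eq_square)
qed

theorem lemma4p1:
  fixes K \<gamma> :: real
    and f_rho f_mom f_theta :: "state \<Rightarrow> state \<Rightarrow> real"
    and S :: "state \<times> real \<Rightarrow> state \<times> real \<Rightarrow> real"
    and \<rho>bar :: "state \<Rightarrow> state \<Rightarrow> real"
  assumes "K > 0" and "\<gamma> > 1"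
    and mean: "density_mean \<rho>bar"
    and flux_i: "\<And>uL uR. admissible uL \<Longrightarrow> admissible uR \<Longrightarrow>
      f_rho uL uR = \<rho>bar uL uR * avg (vel uL) (vel uR)"
    and source_i: "\<And>uL uR \<phi>L \<phi>R. admissible uL \<Longrightarrow> admissible uR \<Longrightarrow>
      S (uL, \<phi>L) (uR, \<phi>R) = \<rho>bar uL uR * jump \<phi>L \<phi>R"
    and rho_consistent: "consistent_flux f_rho (\<lambda>u. dens u * vel u)"
    and rho_symmetric: "symmetric_flux f_rho"
    and mom_ii: "\<And>uL uR. admissible uL \<Longrightarrow> admissible uR \<Longrightarrow>
      f_mom uL uR = f_rho uL uR * avg (vel uL) (vel uR) + avg (pressure K \<gamma> uL) (pressure K \<gamma> uR)"
    and theta_ii: "\<And>uL uR. admissible uL \<Longrightarrow> admissible uR \<Longrightarrow>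
      f_theta uL uR = gamma_mean \<gamma> (dens_theta uL) (dens_theta uR) * avg (vel uL) (vel uR)"
  shows "TEC K \<gamma> (\<lambda>uL uR. (f_rho uL uR, f_mom uL uR, f_theta uL uR)) S"
proof -
  let ?f = "\<lambda>uL uR. (f_rho uL uR, f_mom uL uR, f_theta uL uR)"
  let ?H = "energy_flux K \<gamma> ?f S"
  have consistent: "?H (u, \<phi>) (u, \<phi>) = total_energy_flux K \<gamma> u \<phi>" if adm: "admissible u" for u \<phi>
  proof -
    have q: "dens_theta u > 0"
      using adm by (rule admissible_dens_theta_pos)
    have f: "?f u u = (dens u * vel u, dens u * vel u * vel u + pressure K \<gamma> u, dens_theta u * vel u)"
      using rho_consistent[unfolded consistent_flux_def, rule_format, OF adm]
        mom_ii[OF adm adm] theta_ii[OF adm adm]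
      by (simp add: avg_def gamma_mean_def)
    have S0: "S (u, \<phi>) (u, \<phi>) = 0"
      using source_i[OF adm adm] by (simp add: jump_def)
    have p: "K * dens_theta u powr (\<gamma> - 1) * dens_theta u = pressure K \<gamma> u"
      using q by (simp add: pressure_def powr_diff)
    have "K * \<gamma> / (\<gamma> - 1) * dens_theta u powr (\<gamma> - 1) * (dens_theta u * vel u)
        = \<gamma> / (\<gamma> - 1) * pressure K \<gamma> u * vel u"
      unfolding p[symmetric] by simp
    also have "\<dots> = (pressure K \<gamma> u / (\<gamma> - 1) + pressure K \<gamma> u) * vel u"
      using \<open>\<gamma> > 1\<close> by (simp add: field_simps)
    finally have e: "energy_differential K \<gamma> u \<phi> (?f u u)
        = (\<phi> - (vel u)\<^sup>2 / 2) * (dens u * vel u)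
          + vel u * (dens u * vel u * vel u + pressure K \<gamma> u)
          + (pressure K \<gamma> u / (\<gamma> - 1) + pressure K \<gamma> u) * vel u"
      unfolding energy_differential_def f dens_def mom_def dens_theta_def by simp
    show ?thesis
      unfolding energy_flux_def fst_conv snd_conv e S0 total_energy_flux_def dens_E_def
      by (simp add: algebra_simps power2_eq_square)
  qed
  have right: "?H (uL, \<phi>L) (uR, \<phi>R) = energy_differential K \<gamma> uR \<phi>R (?f uL uR)
      - vel uR * S (uL, \<phi>L) (uR, \<phi>R) / 2 - pressure K \<gamma> uR * vel uR"
    if adm: "admissible uL" "admissible uR" for uL uR \<phi>L \<phi>R
    unfolding energy_flux_def fst_conv snd_conv
    using adm \<open>\<gamma> > 1\<close> flux_i[OF adm] source_i[OF adm]
    by (rule interface_energy_balance) (simp add: mom_ii[OF adm] theta_ii[OF adm])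
  have conservation: "((\<lambda>s. total_energy K \<gamma> (u s i) (\<phi> i)) has_real_derivative
      - (1 / \<Delta>x) * (?H (u t i, \<phi> i) (u t (i + 1), \<phi> (i + 1))
                    - ?H (u t (i - 1), \<phi> (i - 1)) (u t i, \<phi> i))) (at t within T)"
    if adm: "\<And>j. admissible (u t j)" and scheme: "fv_method_at \<Delta>x ?f S \<phi> u T t"
    for \<Delta>x \<phi> u T t i
  proof -
    have "((\<lambda>s. total_energy K \<gamma> (u s i) (\<phi> i)) has_real_derivative
        energy_differential K \<gamma> (u t i) (\<phi> i) (fv_rhs \<Delta>x ?f S \<phi> (u t) i)) (at t within T)"
      using scheme adm unfolding fv_method_at_def
      by (intro total_energy_has_derivative) auto
    also have "energy_differential K \<gamma> (u t i) (\<phi> i) (fv_rhs \<Delta>x ?f S \<phi> (u t) i)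
      = - (1 / \<Delta>x) * (?H (u t i, \<phi> i) (u t (i + 1), \<phi> (i + 1))
                      - ?H (u t (i - 1), \<phi> (i - 1)) (u t i, \<phi> i))"
      \<comment> \<open>At both interfaces the flux is expressed through cell \<open>i\<close>, so its \<open>p v\<close> cancels.\<close>
      unfolding right[OF adm[of "i - 1"] adm[of i]] energy_differential_fv_rhs
      by (simp add: energy_flux_def)
    finally show ?thesis .
  qed
  show ?thesis
    unfolding TEC_def using consistent conservation
    by (intro exI[of _ ?H]) blast
qed

end
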